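(* Let $\mathcal S$ be nested as in the context, and let $p\in I$ and $S'\subsetneq J$ be such that $|S'\cup S_{p-1}|\le n-l<|S'\cup S_p|$. If $p<m$ or $|S_m|<n-l$, then the conditions (L1) $S'\cap S_p=\emptyset$; (L2) $|S'|\le n-l-1$; (L3) $S_{p+1}\setminus S_p\not\subseteq S'$ if $p\le m-1$ are together sufficient for the inequality $$\sum_{j\in S'}z_j\ \ge\ \bigl(|S'\cup S_p|-n+l\bigr)\delta_p+\sum_{i=p+1}^m\bigl(|S'\cup S_i|-|S'\cup S_{i-1}|\bigr)\delta_i$$ to define a facet of $\operatorname{conv}(X^{l,u})$.
   Context: Let $n,m$ be positive integers, $J=\{1,\dots,n\}$, $I=\{1,\dots,m\}$, and let $l,u$ be integers with $0\le l<u$ and $u\ge2$. The sets are nested: $S_1\subsetneq S_2\subsetneq\dots\subsetneq S_m\subsetneq J$, with $|S_1|\ge 2$ and $l\le n-|S_m|$; $\mathcal S=\{S_i\}_{i\in I}$. Put $S_0=\emptyset$. Define $$X^{l,u}=\Bigl\{(z,\delta)\in\{0,1\}^n\times\{0,1\}^m:\ \delta_i=\prod_{j\in S_i}(1-z_j)\ (i\in I),\ l\le\sum_{j\in J}z_j\le u\Bigr\}.$$ *)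

theory Defs
  imports "HOL-Analysis.Analysis"
begin

text \<open>
  The index set \<open>{1,\<dots>,n}\<close> is the finite type \<open>'n\<close>, so \<open>n = CARD('n)\<close>. The coordinates of \<open>\<delta>\<close>
  are indexed by a finite type \<open>'m\<close> whose elements are numbered by \<open>e\<close>, a bijection from
  \<open>{1..CARD('m)}\<close>; the coordinate \<open>\<delta>\<^sub>i\<close> is \<open>\<delta> $ e i\<close>.
\<close>

definition X_set ::
    "int \<Rightarrow> int \<Rightarrow> (nat \<Rightarrow> 'n set) \<Rightarrow> (nat \<Rightarrow> 'm) \<Rightarrow> ((real ^ 'n::finite) \<times> (real ^ 'm::finite)) set" where
  "X_set l u S e =
    {(z, \<delta>). (\<forall>j. z $ j \<in> {0, 1}) \<and> (\<forall>i\<in>{1..CARD('m)}. \<delta> $ e i \<in> {0, 1}) \<and>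
      (\<forall>i\<in>{1..CARD('m)}. \<delta> $ e i = (\<Prod>j\<in>S i. 1 - z $ j)) \<and>
      real_of_int l \<le> (\<Sum>j\<in>UNIV. z $ j) \<and> (\<Sum>j\<in>UNIV. z $ j) \<le> real_of_int u}"

text \<open>The inequality \<open>f x \<ge> g x\<close> is valid for \<open>P\<close> and holds with equality exactly on a facet of \<open>P\<close>.\<close>

definition defines_facet_of :: "('a::euclidean_space \<Rightarrow> real) \<Rightarrow> ('a \<Rightarrow> real) \<Rightarrow> 'a set \<Rightarrow> bool" where
  "defines_facet_of f g P \<longleftrightarrow> (\<forall>x\<in>P. f x \<ge> g x) \<and> {x \<in> P. f x = g x} facet_of P"

end

theory Submission
  imports Defs
begin

text \<open>
  A point of \<open>X\<^sup>l\<^sup>,\<^sup>u\<close> is the incidence vector of a set \<open>T\<close> of indices together with the vector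
  \<open>\<delta>\<close> that \<open>T\<close> determines.  Because the sets \<open>S\<^sub>i\<close> are nested, \<open>\<delta>\<close> carries no more than one
  number, the \<^emph>\<open>level\<close> of \<open>T\<close>: the largest \<open>t\<close> such that \<open>T\<close> misses \<open>S\<^sub>t\<close>.  A linear
  form in \<open>\<delta>\<close> is therefore a function of the level, and its coefficients are the increments of
  that function.  The right-hand side of the inequality belongs in this way to the function
  \<open>excess t = l - (n - |S' \<union> S\<^sub>t|)\<close> for \<open>t \<ge> p\<close> and \<open>excess t = 0\<close> for \<open>t < p\<close>, so that the
  inequality reads \<open>|T \<inter> S'| \<ge> excess (level T)\<close>.

  \<^bold>\<open>Validity.\<close>  A set of level \<open>t\<close> with at least \<open>l\<close> elements has at most \<open>n - |S' \<union> S\<^sub>t|\<close> of them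
  outside \<open>S'\<close>, and the others lie in \<open>S'\<close> (\<open>excess_le_card\<close>).

  \<^bold>\<open>Dimension.\<close>  It suffices that every linear form which is constant on the tight points is a
  multiple of the form \<open>w\<close> of the inequality (\<open>facet_of_supporting_hyperplane\<close>).  Let \<open>a\<close> be
  the coefficients of such a form on \<open>z\<close>, let \<open>B\<close> be its part in \<open>\<delta>\<close> as a function of the level,
  and let \<open>c\<close> be its constant value.
  Below level \<open>p\<close> the tight sets are those that miss \<open>S'\<close>; there is room for sets of size
  \<open>l\<close> and \<open>l + 1\<close>, which forces \<open>a = 0\<close> outside \<open>S'\<close>, \<open>c = 0\<close> and \<open>B = 0\<close> below \<open>p\<close>
  (\<open>form_zero_off_S'\<close>, \<open>form_zero_below_p\<close>).  At a level \<open>t \<ge> p\<close> the tight sets consist of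
  everything outside \<open>S' \<union> S\<^sub>t\<close> and of \<open>excess t\<close> elements of \<open>S' - S\<^sub>t\<close>.  At level \<open>p\<close>, any
  subset of \<open>S'\<close> of size \<open>excess p\<close> will do, and \<open>0 < excess p < |S'|\<close>; exchanging one element for
  another shows that \<open>a\<close> is constant on \<open>S'\<close> (\<open>form_constant_on_S'\<close>).  Finally, one tight set at
  each level determines \<open>B\<close> (\<open>tight_form_unique\<close>).
\<close>

section \<open>A criterion for facets\<close>

text \<open>
  The forms that are constant on a face are the normals of its affine hull.  If they all are
  multiples of \<open>w\<close>, the face has dimension at least \<open>DIM - 1\<close>; being a proper face of \<open>P\<close>, it has
  dimension at most \<open>aff_dim P - 1\<close>.  So \<open>P\<close> is full-dimensional as a by-product.
\<close>

lemma facet_of_supporting_hyperplane: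
  fixes P :: "'a::euclidean_space set"
  assumes conv: "convex P" and valid: "\<And>x. x \<in> P \<Longrightarrow> w \<bullet> x \<ge> c"
    and ne: "P \<inter> {x. w \<bullet> x = c} \<noteq> {}" and proper: "x0 \<in> P" "w \<bullet> x0 \<noteq> c"
    and normals: "\<And>v d. \<forall>x \<in> P \<inter> {x. w \<bullet> x = c}. v \<bullet> x = d \<Longrightarrow> \<exists>k. v = k *\<^sub>R w"
  shows "(P \<inter> {x. w \<bullet> x = c}) facet_of P"
proof -
  define F where "F = P \<inter> {x. w \<bullet> x = c}"
  have face: "F face_of P"
    unfolding F_def using face_of_Int_supporting_hyperplane_ge[OF conv valid] .
  have "F \<noteq> P" using proper by (auto simp: F_def)
  then have less: "aff_dim F < aff_dim P" using face_of_aff_dim_lt[OF conv face] by blast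
  obtain a where a: "a \<in> F" using ne by (auto simp: F_def)
  define D where "D = (+) (- a) ` F"
  define N where "N = {y \<in> UNIV. \<forall>x \<in> span D. orthogonal x y}"
  have "aff_dim F = int (dim (span D))"
    using aff_dim_eq_dim[of a F] a by (simp add: hull_inc D_def)
  moreover have "dim N + dim (span D) = DIM('a)"
    using dim_subspace_orthogonal_to_vectors[of "span D" UNIV] by (simp add: N_def)
  moreover have "N \<subseteq> span {w}"
  proof
    fix v assume v: "v \<in> N"
    have "v \<bullet> x = v \<bullet> a" if "x \<in> F" for x
    proof -
      have "x - a \<in> span D" using that by (intro span_base) (auto simp: D_def)
      then have "(x - a) \<bullet> v = 0" using v by (auto simp: N_def orthogonal_def)
      then show ?thesis by (simp add: inner_diff_left inner_commute[of v])
    qed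
    then show "v \<in> span {w}" using normals[of v "v \<bullet> a"] by (auto simp: F_def span_singleton)
  qed
  then have "dim N \<le> 1"
    using dim_le_card[of N "{w}"] by simp
  ultimately have "aff_dim F \<ge> int DIM('a) - 1" by linarith
  with less aff_dim_le_DIM[of P] have "aff_dim F = aff_dim P - 1" by linarith
  with face a show ?thesis by (auto simp: facet_of_def F_def)
qed

section \<open>The level of a set with respect to a chain\<close>

locale nested_chain =
  fixes m :: nat and S :: "nat \<Rightarrow> 'n::finite set"
  assumes S_0: "S 0 = {}" and S_Suc: "i < m \<Longrightarrow> S i \<subset> S (Suc i)"
begin

lemma S_mono: "i \<le> j \<Longrightarrow> j \<le> m \<Longrightarrow> S i \<subseteq> S j"
proof (induction j rule: dec_induct)
  case (step k)
  then show ?case using S_Suc[of k] by auto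
qed auto

definition level :: "'n set \<Rightarrow> nat" where
  "level T = Max {i. i \<le> m \<and> S i \<inter> T = {}}"

lemma level_le: "level T \<le> m" and level_disjoint: "S (level T) \<inter> T = {}"
proof -
  have "level T \<in> {i. i \<le> m \<and> S i \<inter> T = {}}"
    unfolding level_def by (rule Max_in) (auto intro!: exI[of _ 0] simp: S_0)
  then show "level T \<le> m" "S (level T) \<inter> T = {}" by auto
qed

lemma disjoint_iff_level:
  assumes "i \<le> m"
  shows "S i \<inter> T = {} \<longleftrightarrow> i \<le> level T"
proof
  assume "S i \<inter> T = {}"
  then show "i \<le> level T" unfolding level_def using assms by (intro Max_ge) auto
next
  assume "i \<le> level T"
  then show "S i \<inter> T = {}" using S_mono[OF _ level_le] level_disjoint[of T] by blast
qed

lemma level_eqI: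
  assumes "t \<le> m" "S t \<inter> T = {}" "t < m \<Longrightarrow> S (Suc t) \<inter> T \<noteq> {}"
  shows "level T = t"
proof (rule antisym)
  show "t \<le> level T" using assms disjoint_iff_level by blast
  show "level T \<le> t"
    using assms disjoint_iff_level[of "Suc t" T] level_le[of T] by (cases "t < m") auto
qed

end

section \<open>The inequality in terms of levels\<close>

lemma card_Compl_add:
  fixes A :: "'a::finite set"
  shows "card (- A) + card A = CARD('a)"
  by (simp add: Compl_eq_Diff_UNIV card_Diff_subset card_mono)

text \<open>
  The conditions of the theorem, over the natural numbers and without the variables \<open>\<delta>\<close>.  The
  hypothesis \<open>S_p_small\<close> is what \<open>p < m\<close> or \<open>|S\<^sub>m| < n - l\<close> is for: since the chain is
  strict, either of them gives \<open>|S\<^sub>p| < n - l\<close>.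
\<close>

locale lifted_cover = nested_chain m S
  for m and S :: "nat \<Rightarrow> 'n::finite set" +
  fixes l u p :: nat and S' :: "'n set"
  assumes lu: "l < u" "2 \<le> u"
    and S_1: "2 \<le> card (S 1)"
    and S_m: "l + card (S m) \<le> CARD('n)"
    and p: "1 \<le> p" "p \<le> m"
    and below_p: "l + card (S' \<union> S (p - 1)) \<le> CARD('n)"
    and at_p: "CARD('n) < l + card (S' \<union> S p)"
    and S_p_small: "l + card (S p) < CARD('n)"
    and L1: "S' \<inter> S p = {}"
    and L2: "l + card S' < CARD('n)"
    and L3: "p < m \<Longrightarrow> \<not> S (Suc p) - S p \<subseteq> S'"
begin

lemma l_pos: "1 \<le> l"
  using at_p card_mono[of UNIV "S' \<union> S p"] by simp

lemma S'_nonempty: "S' \<noteq> {}"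
  using at_p S_p_small by auto

lemma S'_S_1_disjoint: "S' \<inter> S 1 = {}"
  using S_mono[OF p] L1 by blast

definition excess :: "nat \<Rightarrow> real" where
  "excess t = (if t < p then 0 else real l + real (card (S' \<union> S t)) - real CARD('n))"

text \<open>
  From level \<open>p\<close> on, the excess counts the elements that a tight set has in \<open>S'\<close>; there the
  subtraction below does not truncate.
\<close>

definition excess_card :: "nat \<Rightarrow> nat" where
  "excess_card t = l + card (S' \<union> S t) - CARD('n)"

lemma excess_0 [simp]: "excess 0 = 0"
  using p by (simp add: excess_def)

lemma excess_card_pos:
  assumes "p \<le> t" "t \<le> m"
  shows "CARD('n) < l + card (S' \<union> S t)"
  using at_p S_mono[OF assms] card_mono[of "S' \<union> S t" "S' \<union> S p"] by fastforce

lemma excess_eq_card: "p \<le> t \<Longrightarrow> t \<le> m \<Longrightarrow> excess t = real (excess_card t)"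
  using excess_card_pos[of t] by (simp add: excess_def excess_card_def)

text \<open>
  \<open>excess_card t\<close> elements can be found in \<open>S' - S\<^sub>t\<close>, because at most \<open>n - l\<close> positions are lost to
  \<open>S\<^sub>t\<close>.
\<close>

lemma excess_card_le:
  assumes "p \<le> t" "t \<le> m"
  shows "excess_card t \<le> card (S' - S t)"
proof -
  have "card (S' \<union> S t) = card (S' - S t) + card (S t)"
    by (metis Diff_disjoint Int_commute Un_Diff_cancel2 card_Un_disjoint finite)
  moreover have "card (S t) \<le> card (S m)" using S_mono[of t m] assms by (simp add: card_mono)
  ultimately show ?thesis using S_m by (simp add: excess_card_def)
qed

lemma excess_le_card:
  assumes "l \<le> card T"
  shows "excess (level T) \<le> real (card (T \<inter> S'))"
proof (cases "level T < p")
  case False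
  let ?t = "level T"
  have "T \<subseteq> (T \<inter> S') \<union> - (S' \<union> S ?t)" using level_disjoint[of T] by blast
  then have "card T \<le> card (T \<inter> S') + card (- (S' \<union> S ?t))"
    by (meson card_Un_le card_mono finite order_trans)
  moreover have "card (- (S' \<union> S ?t)) + card (S' \<union> S ?t) = CARD('n)"
    by (rule card_Compl_add)
  ultimately show ?thesis using False assms by (simp add: excess_def)
qed (simp add: excess_def)

section \<open>Tight sets\<close>

definition tight :: "'n set \<Rightarrow> bool" where
  "tight T \<longleftrightarrow> l \<le> card T \<and> card T \<le> u \<and> real (card (T \<inter> S')) = excess (level T)"

lemma tight_below_p:
  assumes "T \<inter> S' = {}" "l \<le> card T" "card T \<le> u" "level T < p"
  shows "tight T"
  using assms by (simp add: tight_def excess_def)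

text \<open>
  Room outside \<open>S'\<close>: by (L2) a set of \<open>l\<close> elements avoiding \<open>S'\<close> can be chosen to leave out a
  further index \<open>j\<close>, while an element of \<open>S\<^sub>1\<close> other than \<open>j\<close> keeps its level at 0.
\<close>

lemma tight_level_0:
  obtains T where "j \<notin> T" "T \<inter> S' = {}" "card T = l" "S 1 \<inter> T \<noteq> {}"
proof -
  have "\<not> S 1 \<subseteq> {j}" using S_1 card_mono[of "{j}" "S 1"] by auto
  then obtain s where s: "s \<in> S 1" "s \<noteq> j" by blast
  have "card (insert j S') \<le> Suc (card S')" by (simp add: card_insert_if)
  then have "l \<le> card (- insert j S')" using L2 card_Compl_add[of "insert j S'"] by linarith
  moreover have "{s} \<subseteq> - insert j S'" using s S'_S_1_disjoint by blast
  ultimately obtain T where "{s} \<subseteq> T" "T \<subseteq> - insert j S'" "card T = l"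
    using exists_subset_between[of "{s}" l "- insert j S'"] l_pos by auto
  then show ?thesis using that[of T] s by auto
qed

lemma level_0I: "S 1 \<inter> T \<noteq> {} \<Longrightarrow> level T = 0"
  by (rule level_eqI) (auto simp: S_0)

lemma ex_tight: "\<exists>T. tight T"
proof -
  fix j :: 'n
  obtain T where T: "j \<notin> T" "T \<inter> S' = {}" "card T = l" "S 1 \<inter> T \<noteq> {}"
    by (rule tight_level_0)
  have "tight T" by (rule tight_below_p) (use T level_0I[of T] lu p in simp_all)
  then show ?thesis ..
qed

text \<open>
  A set that meets both \<open>S\<^sub>1\<close> and \<open>S'\<close> has excess 0 but is not disjoint from \<open>S'\<close>.  This is
  where \<open>u \<ge> 2\<close> enters.
\<close>

lemma ex_not_tight:
  obtains T where "l \<le> card T" "card T \<le> u" "real (card (T \<inter> S')) \<noteq> excess (level T)"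
proof -
  obtain s where s: "s \<in> S 1" using S_1 by (metis card.empty equals0I not_numeral_le_zero)
  obtain x where x: "x \<in> S'" using S'_nonempty by blast
  have "card (S 1) \<le> CARD('n)" by (simp add: card_mono)
  then have "max l 2 \<le> card (UNIV :: 'n set)" using S_1 S_m by auto
  moreover have "card {s, x} \<le> max l 2" by (simp add: card_insert_if le_max_iff_disj)
  ultimately obtain T where T: "{s, x} \<subseteq> T" "card T = max l 2"
    using exists_subset_between[of "{s, x}" "max l 2" UNIV] by auto
  have "level T = 0" using T s by (intro level_0I) auto
  moreover have "card (T \<inter> S') \<noteq> 0" using T x by auto
  ultimately show ?thesis using that[of T] T lu by auto
qed

text \<open>
  Outside \<open>S' \<union> S\<^sub>t\<close> there are \<open>l - excess_card t\<close> positions; filling them all and adding \<open>R\<close>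
  gives exactly \<open>l\<close> elements.  Hence the choice of \<open>R\<close> is the only freedom at level \<open>t\<close>, and \<open>hit\<close>
  is what keeps the level from exceeding \<open>t\<close>.
\<close>

lemma tight_above_p:
  assumes t: "p \<le> t" "t \<le> m" and R: "R \<subseteq> S' - S t" "card R = excess_card t"
    and hit: "t < m \<Longrightarrow> S (Suc t) \<inter> (R \<union> - (S' \<union> S t)) \<noteq> {}"
  shows "tight (R \<union> - (S' \<union> S t))" "level (R \<union> - (S' \<union> S t)) = t"
proof -
  let ?T = "R \<union> - (S' \<union> S t)"
  show lev: "level ?T = t" using t R hit by (intro level_eqI) auto
  have "card ?T = card R + card (- (S' \<union> S t))"
    using R by (intro card_Un_disjoint) auto
  moreover have "card (- (S' \<union> S t)) + card (S' \<union> S t) = CARD('n)"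
    by (rule card_Compl_add)
  ultimately have "card ?T = l" using R excess_card_pos[OF t] by (simp add: excess_card_def)
  moreover have "?T \<inter> S' = R" using R by auto
  ultimately show "tight ?T"
    using lev R lu excess_eq_card[OF t] by (simp add: tight_def)
qed

text \<open>
  Either the new elements of \<open>S\<^bsub>t+1\<^esub>\<close> all lie in \<open>S'\<close>, and one of them can be put into \<open>R\<close>, or the
  complement of \<open>S' \<union> S\<^sub>t\<close> already meets \<open>S\<^bsub>t+1\<^esub>\<close>.
\<close>

lemma ex_tight_above_p:
  assumes t: "p \<le> t" "t \<le> m"
  obtains R where "R \<subseteq> S' - S t" "card R = excess_card t"
    "t < m \<Longrightarrow> S (Suc t) \<inter> (R \<union> - (S' \<union> S t)) \<noteq> {}"
proof -
  \<comment> \<open>\<open>A\<close> consists of one new element of the next set of the chain; \<open>R\<close> has to contain it only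
      if it lies in \<open>S'\<close>.\<close>
  define A where "A = (if t < m then {SOME s. s \<in> S (Suc t) - S t} else {})"
  have A: "\<exists>s \<in> S (Suc t) - S t. A = {s}" if "t < m"
    using S_Suc[OF that] that someI_ex[of "\<lambda>s. s \<in> S (Suc t) - S t"] by (auto simp: A_def)
  have "card (A \<inter> S') \<le> 1"
    using card_mono[of A "A \<inter> S'"] by (auto simp: A_def split: if_splits)
  also have "1 \<le> excess_card t" using excess_card_pos[OF t] by (simp add: excess_card_def)
  finally have "card (A \<inter> S') \<le> excess_card t" .
  moreover have "A \<inter> S' \<subseteq> S' - S t" using A by (cases "t < m") (auto simp: A_def)
  ultimately obtain R where R: "A \<inter> S' \<subseteq> R" "R \<subseteq> S' - S t" "card R = excess_card t"
    using exists_subset_between[of "A \<inter> S'" "excess_card t" "S' - S t"] excess_card_le[OF t]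
    by auto
  show ?thesis
  proof (rule that[OF R(2,3)])
    assume "t < m"
    then show "S (Suc t) \<inter> (R \<union> - (S' \<union> S t)) \<noteq> {}" using A R(1) by blast
  qed
qed

section \<open>Forms that are constant on the tight sets\<close>

context
  fixes a :: "'n \<Rightarrow> real" and B :: "nat \<Rightarrow> real" and c :: real
  assumes B_0: "B 0 = 0"
    and const: "tight T \<Longrightarrow> sum a T + B (level T) = c"
begin

text \<open>
  A tight set of \<open>l < u\<close> elements at level 0 stays tight when \<open>j\<close> is added.
\<close>

lemma form_zero_off_S':
  assumes "j \<notin> S'"
  shows "a j = 0"
proof -
  obtain T where T: "j \<notin> T" "T \<inter> S' = {}" "card T = l" "S 1 \<inter> T \<noteq> {}"
    by (rule tight_level_0)
  have "level T = 0" "level (insert j T) = 0" using T by (auto intro!: level_0I)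
  moreover have "tight T" by (rule tight_below_p) (use T lu p calculation in simp_all)
  moreover have "tight (insert j T)"
    by (rule tight_below_p) (use T assms lu p calculation in simp_all)
  ultimately have "sum a (insert j T) = sum a T" using const[of T] const[of "insert j T"] by simp
  then show ?thesis using T by simp
qed

text \<open>
  The condition \<open>|S' \<union> S\<^bsub>p-1\<^esub>| \<le> n - l\<close> leaves room for a set of \<open>l\<close> elements that misses \<open>S'\<close>
  and has any prescribed level below \<open>p\<close>.  At level 0, where \<open>B\<close> vanishes, this gives \<open>c = 0\<close>.
\<close>

lemma form_zero_below_p:
  assumes "t < p"
  shows "B t = c"
proof -
  obtain s where s: "s \<in> S (Suc t)" "s \<notin> S t" using S_Suc[of t] assms p by auto
  have "s \<notin> S'" using s S_mono[of "Suc t" p] assms p L1 by auto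
  have "S t \<subseteq> S (p - 1)" using assms p by (intro S_mono) auto
  then have "card (S' \<union> S t) \<le> card (S' \<union> S (p - 1))" by (intro card_mono) auto
  then have "l \<le> card (- (S' \<union> S t))" using below_p card_Compl_add[of "S' \<union> S t"] by linarith
  with s \<open>s \<notin> S'\<close> obtain T where T: "{s} \<subseteq> T" "T \<subseteq> - (S' \<union> S t)" "card T = l"
    using exists_subset_between[of "{s}" l "- (S' \<union> S t)"] l_pos by auto
  have lev: "level T = t" using T s assms p by (intro level_eqI) auto
  then have "tight T" using T assms lu by (intro tight_below_p) auto
  moreover have "sum a T = 0" using T by (intro sum.neutral) (auto intro: form_zero_off_S')
  ultimately show ?thesis using const[of T] lev by simp
qed

lemma form_constant_zero: "c = 0"
  using form_zero_below_p[of 0] p B_0 by simp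

lemma form_above_p:
  assumes t: "p \<le> t" "t \<le> m" and R: "R \<subseteq> S' - S t" "card R = excess_card t"
    and hit: "t < m \<Longrightarrow> S (Suc t) \<inter> (R \<union> - (S' \<union> S t)) \<noteq> {}"
  shows "sum a R + B t = 0"
proof -
  let ?T = "R \<union> - (S' \<union> S t)"
  have "sum a ?T = sum a R" by (rule sum.mono_neutral_right) (auto intro: form_zero_off_S')
  then show ?thesis
    using const[OF tight_above_p(1)[OF assms]] tight_above_p(2)[OF assms] form_constant_zero
    by simp
qed

text \<open>
  By (L3) every subset of \<open>S'\<close> of size \<open>excess_card p\<close> gives a tight set of level \<open>p\<close>, whether or
  not it meets \<open>S\<^bsub>p+1\<^esub>\<close>.  Two such sets that differ in one element exist for any \<open>x\<close> and \<open>y\<close> in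
  \<open>S'\<close>, because \<open>excess_card p\<close> lies strictly between 0 and \<open>|S'|\<close>.
\<close>

lemma form_constant_on_S':
  assumes "x \<in> S'" "y \<in> S'"
  shows "a x = a y"
proof (cases "x = y")
  case False
  have "card (S' \<union> S p) = card S' + card (S p)" using L1 by (intro card_Un_disjoint) auto
  then have less: "excess_card p < card S'" using S_p_small at_p by (simp add: excess_card_def)
  have pos: "0 < excess_card p" using at_p by (simp add: excess_card_def)
  have "card (S' - {x, y}) = card S' - 2"
    using assms False by (subst card_Diff_subset) auto
  then have "excess_card p - 1 \<le> card (S' - {x, y})" using less by simp
  then obtain Q where Q: "Q \<subseteq> S' - {x, y}" "card Q = excess_card p - 1"
    by (meson obtain_subset_with_card_n)
  have "sum a (insert z Q) + B p = 0" if "z \<in> {x, y}" for z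
  proof (rule form_above_p)
    show "insert z Q \<subseteq> S' - S p" using that Q assms L1 by auto
    show "card (insert z Q) = excess_card p" using that Q pos by (auto simp: card_insert_if)
    show "S (Suc p) \<inter> (insert z Q \<union> - (S' \<union> S p)) \<noteq> {}" if "p < m" using L3[OF that] by blast
  qed (use p in auto)
  from this[of x] this[of y] have "sum a (insert x Q) = sum a (insert y Q)" by simp
  moreover have "x \<notin> Q" "y \<notin> Q" using Q by auto
  ultimately show ?thesis by simp
qed simp

lemma tight_form_unique:
  obtains k where "\<And>j. a j = k * of_bool (j \<in> S')" "\<And>t. t \<le> m \<Longrightarrow> B t = - k * excess t"
proof -
  obtain x where x: "x \<in> S'" using S'_nonempty by blast
  have "a j = a x * of_bool (j \<in> S')" for j
    using form_constant_on_S'[OF x, of j] form_zero_off_S'[of j] by simp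
  moreover have "B t = - a x * excess t" if "t \<le> m" for t
  proof (cases "t < p")
    case True
    then show ?thesis using form_zero_below_p form_constant_zero by (simp add: excess_def)
  next
    case False
    then have t: "p \<le> t" by simp
    obtain R where R: "R \<subseteq> S' - S t" "card R = excess_card t"
      and hit: "t < m \<Longrightarrow> S (Suc t) \<inter> (R \<union> - (S' \<union> S t)) \<noteq> {}"
      using ex_tight_above_p[OF t \<open>t \<le> m\<close>] by blast
    have "sum a R = (\<Sum>j\<in>R. a x)"
      using R form_constant_on_S'[OF _ x] by (intro sum.cong) auto
    then show ?thesis
      using form_above_p[OF t \<open>t \<le> m\<close> R hit] R(2) excess_eq_card[OF t \<open>t \<le> m\<close>]
      by (simp add: mult.commute)
  qed
  ultimately show ?thesis using that by blast
qed

end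

end

section \<open>Points of the polytope\<close>

text \<open>
  The inverse of the numbering \<open>e\<close> recovers from a coordinate of \<open>\<delta>\<close> the set \<open>S\<^sub>i\<close> it belongs to.
\<close>

definition incidence_point ::
    "(nat \<Rightarrow> 'n set) \<Rightarrow> (nat \<Rightarrow> 'm) \<Rightarrow> 'n set \<Rightarrow> (real ^ 'n::finite) \<times> (real ^ 'm::finite)" where
  "incidence_point S e T =
    (\<chi> j. of_bool (j \<in> T), \<chi> k. of_bool (S (inv_into {1..CARD('m)} e k) \<inter> T = {}))"

lemma prod_one_minus_of_bool:
  "finite A \<Longrightarrow> (\<Prod>j\<in>A. 1 - of_bool (j \<in> T) :: real) = of_bool (A \<inter> T = {})"
  by (induction A rule: finite_induct) auto

lemma X_set_eq_incidence_points:
  fixes S :: "nat \<Rightarrow> 'n::finite set" and e :: "nat \<Rightarrow> 'm::finite"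
  assumes e: "bij_betw e {1..CARD('m)} UNIV"
  shows "X_set (int l) (int u) S e = incidence_point S e ` {T. l \<le> card T \<and> card T \<le> u}"
proof -
  have inv: "inv_into {1..CARD('m)} e (e i) = i" if "i \<in> {1..CARD('m)}" for i
    using bij_betw_inv_into_left[OF e that] .
  have "incidence_point S e T \<in> X_set (int l) (int u) S e" if "l \<le> card T" "card T \<le> u" for T
    using that inv
    by (simp add: X_set_def incidence_point_def prod_one_minus_of_bool)
  moreover have "\<exists>T. l \<le> card T \<and> card T \<le> u \<and> (z, \<delta>) = incidence_point S e T"
    if X: "(z, \<delta>) \<in> X_set (int l) (int u) S e" for z \<delta>
  proof -
    define T where "T = {j. z $ j = 1}"
    have z: "z $ j = of_bool (j \<in> T)" for j using X by (auto simp: X_set_def T_def)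
    have d: "\<delta> $ e i = of_bool (S i \<inter> T = {})" if "i \<in> {1..CARD('m)}" for i
      using X that by (auto simp: X_set_def z prod_one_minus_of_bool)
    have "(z, \<delta>) = incidence_point S e T"
    proof -
      have "\<delta> $ k = of_bool (S (inv_into {1..CARD('m)} e k) \<inter> T = {})" for k
        using d[of "inv_into {1..CARD('m)} e k"] e
        by (metis UNIV_I bij_betw_def f_inv_into_f inv_into_into)
      then show ?thesis by (simp add: incidence_point_def vec_eq_iff z)
    qed
    moreover have "(\<Sum>j\<in>UNIV. z $ j) = real (card T)" by (simp add: z)
    ultimately show ?thesis using X by (auto simp: X_set_def)
  qed
  ultimately show ?thesis by (auto simp: image_iff)
qed

text \<open>
  Since \<open>\<delta>\<^sub>i = 1\<close> exactly for \<open>i \<le> level T\<close>, a form in \<open>\<delta>\<close> is a partial sum of its coefficients.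
\<close>

lemma (in nested_chain) inner_incidence_point:
  fixes a :: "real ^ 'n" and b :: "real ^ 'm::finite"
  assumes e: "bij_betw e {1..m} UNIV" and m: "m = CARD('m)"
  shows "(a, b) \<bullet> incidence_point S e T = (\<Sum>j\<in>T. a $ j) + (\<Sum>i=1..level T. b $ e i)"
proof -
  have "(\<Sum>k\<in>UNIV. b $ k * of_bool (S (inv_into {1..m} e k) \<inter> T = {}))
      = (\<Sum>i\<in>{1..m}. b $ e i * of_bool (S i \<inter> T = {}))"
    by (subst sum.reindex_bij_betw[OF e, symmetric], rule sum.cong)
      (auto simp: bij_betw_inv_into_left[OF e, simplified])
  also have "\<dots> = (\<Sum>i=1..level T. b $ e i)"
    by (rule sum.mono_neutral_cong_right) (use level_le[of T] disjoint_iff_level in auto)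
  finally show ?thesis
    by (simp add: incidence_point_def inner_vec_def m if_distrib sum.If_cases)
qed

section \<open>The facet\<close>

context lifted_cover
begin

context
  fixes e :: "nat \<Rightarrow> 'm::finite"
  assumes e: "bij_betw e {1..m} UNIV" and m: "m = CARD('m)"
begin

text \<open>
  The coefficient of \<open>\<delta>\<^sub>i\<close> is the increment of the excess at \<open>i\<close>, so that the sum over the levels
  up to \<open>level T\<close> telescopes to \<open>excess (level T)\<close>.
\<close>

definition facet_normal :: "(real ^ 'n) \<times> (real ^ 'm)" where
  "facet_normal = (\<chi> j. of_bool (j \<in> S'),
     \<chi> k. - (excess (inv_into {1..m} e k) - excess (inv_into {1..m} e k - 1)))"

lemma facet_normal_inner_incidence_point:
  "facet_normal \<bullet> incidence_point S e T = real (card (T \<inter> S')) - excess (level T)"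
proof -
  have "(\<Sum>i=1..level T. (\<chi> k. - (excess (inv_into {1..m} e k)
        - excess (inv_into {1..m} e k - 1))) $ e i)
      = - (\<Sum>i=Suc 0..level T. excess i - excess (i - 1))"
    unfolding sum_negf[symmetric]
    by (rule sum.cong) (use level_le[of T] in \<open>auto simp: bij_betw_inv_into_left[OF e, simplified]\<close>)
  also have "\<dots> = - excess (level T)" by (subst sum_telescope'') auto
  finally show ?thesis
    unfolding facet_normal_def inner_incidence_point[OF e m] by (simp add: sum.If_cases Int_commute)
qed

lemma facet_normal_inner:
  "facet_normal \<bullet> (z, \<delta>) = (\<Sum>j\<in>S'. z $ j)
    - ((real l + real (card (S' \<union> S p)) - real CARD('n)) * \<delta> $ e p
      + (\<Sum>i=p+1..m. (real (card (S' \<union> S i)) - real (card (S' \<union> S (i - 1)))) * \<delta> $ e i))"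
proof -
  let ?D = "\<lambda>i. (excess i - excess (i - 1)) * \<delta> $ e i"
  have "(\<Sum>k\<in>UNIV. (excess (inv_into {1..m} e k) - excess (inv_into {1..m} e k - 1)) * \<delta> $ k)
      = (\<Sum>i\<in>{1..m}. ?D i)"
    by (subst sum.reindex_bij_betw[OF e, symmetric], rule sum.cong)
      (auto simp: bij_betw_inv_into_left[OF e, simplified])
  also have "\<dots> = (\<Sum>i\<in>{p..m}. ?D i)"
    by (rule sum.mono_neutral_right) (use p in \<open>auto simp: excess_def\<close>)
  also have "\<dots> = ?D p + (\<Sum>i=p+1..m. ?D i)"
    using p by (simp add: sum.atLeast_Suc_atMost)
  also have "(\<Sum>i=p+1..m. ?D i)
      = (\<Sum>i=p+1..m. (real (card (S' \<union> S i)) - real (card (S' \<union> S (i - 1)))) * \<delta> $ e i)"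
    by (rule sum.cong) (auto simp: excess_def)
  also have "?D p = (real l + real (card (S' \<union> S p)) - real CARD('n)) * \<delta> $ e p"
    using p by (simp add: excess_def)
  finally show ?thesis
    unfolding facet_normal_def inner_Pair inner_vec_def
    by (simp add: sum_negf sum.If_cases del: minus_diff_eq)
qed

lemma facet_normal_nonneg:
  assumes "x \<in> convex hull (X_set (int l) (int u) S e)"
  shows "facet_normal \<bullet> x \<ge> 0"
proof -
  have "X_set (int l) (int u) S e = incidence_point S e ` {T. l \<le> card T \<and> card T \<le> u}"
    by (rule X_set_eq_incidence_points) (use e m in simp)
  then have "X_set (int l) (int u) S e \<subseteq> {x. facet_normal \<bullet> x \<ge> 0}"
    using facet_normal_inner_incidence_point excess_le_card by (simp add: image_subset_iff)
  then have "convex hull (X_set (int l) (int u) S e) \<subseteq> {x. facet_normal \<bullet> x \<ge> 0}"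
    by (intro hull_minimal convex_halfspace_ge)
  with assms show ?thesis by auto
qed

lemma facet_normal_facet:
  defines "P \<equiv> convex hull (X_set (int l) (int u) S e)"
  shows "(P \<inter> {x. facet_normal \<bullet> x = 0}) facet_of P"
proof -
  have X: "X_set (int l) (int u) S e = incidence_point S e ` {T. l \<le> card T \<and> card T \<le> u}"
    by (rule X_set_eq_incidence_points) (use e m in simp)
  have in_P: "incidence_point S e T \<in> P" if "l \<le> card T" "card T \<le> u" for T
    using that unfolding P_def X by (intro hull_inc) auto
  have in_F: "incidence_point S e T \<in> P \<inter> {x. facet_normal \<bullet> x = 0}" if "tight T" for T
    using that in_P[of T] by (simp add: tight_def facet_normal_inner_incidence_point)
  obtain T0 where T0: "l \<le> card T0" "card T0 \<le> u" "real (card (T0 \<inter> S')) \<noteq> excess (level T0)"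
    using ex_not_tight .
  show ?thesis
  proof (rule facet_of_supporting_hyperplane[where ?x0.0 = "incidence_point S e T0"])
    show "convex P" by (simp add: P_def)
    show "facet_normal \<bullet> x \<ge> 0" if "x \<in> P" for x using facet_normal_nonneg that P_def by blast
    show "P \<inter> {x. facet_normal \<bullet> x = 0} \<noteq> {}" using ex_tight in_F by blast
    show "incidence_point S e T0 \<in> P" using in_P T0 by blast
    show "facet_normal \<bullet> incidence_point S e T0 \<noteq> 0"
      using T0 by (simp add: facet_normal_inner_incidence_point)
  next
    fix v :: "(real ^ 'n) \<times> (real ^ 'm)" and d
    assume v: "\<forall>x \<in> P \<inter> {x. facet_normal \<bullet> x = 0}. v \<bullet> x = d"
    obtain a b where ab: "v = (a, b)" by (cases v)
    define B where "B t = (\<Sum>i=1..t. b $ e i)" for t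
    have "(\<Sum>j\<in>T. a $ j) + B (level T) = d" if "tight T" for T
      using bspec[OF v in_F[OF that]] by (simp add: ab B_def inner_incidence_point[OF e m])
    then obtain k where k: "\<And>j. a $ j = k * of_bool (j \<in> S')"
        "\<And>t. t \<le> m \<Longrightarrow> B t = - k * excess t"
      using tight_form_unique[of B "($) a" d] by (auto simp: B_def)
    have "b $ i = k * (- (excess (inv_into {1..m} e i) - excess (inv_into {1..m} e i - 1)))" for i
    proof -
      define q where "q = inv_into {1..m} e i"
      have "i \<in> e ` {1..m}" using e by (simp add: bij_betw_def)
      then have q: "q \<in> {1..m}" "e q = i"
        unfolding q_def by (rule inv_into_into, rule f_inv_into_f)
      have "B q = B (q - 1) + b $ e q"
        using q by (cases q) (auto simp: B_def)
      moreover have "B q = - k * excess q" "B (q - 1) = - k * excess (q - 1)"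
        using k(2)[of q] k(2)[of "q - 1"] q by auto
      ultimately show ?thesis using q unfolding q_def[symmetric] by (simp add: algebra_simps)
    qed
    then have "v = k *\<^sub>R facet_normal"
      by (simp add: ab facet_normal_def vec_eq_iff k(1))
    then show "\<exists>k. v = k *\<^sub>R facet_normal" ..
  qed
qed

end

end

theorem theorem18:
  fixes l u n :: int and m p :: nat
    and S :: "nat \<Rightarrow> 'n::finite set" and S' :: "'n set" and e :: "nat \<Rightarrow> 'm::finite"
  assumes n: "n = int CARD('n)" and m: "m = CARD('m)"
    and e: "bij_betw e {1..m} UNIV"
    and lu: "0 \<le> l" "l < u" "2 \<le> u"
    and S0: "S 0 = {}"
    and S_card: "2 \<le> card (S 1)"
    and S_nested: "\<forall>i\<in>{1..<m}. S i \<subset> S (i + 1)"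
    and S_top: "S m \<subset> UNIV"
    and l_le: "l \<le> n - int (card (S m))"
    and p: "p \<in> {1..m}"
    and S': "S' \<subset> UNIV"
    and p_cond: "int (card (S' \<union> S (p - 1))) \<le> n - l" "n - l < int (card (S' \<union> S p))"
    and case_cond: "p < m \<or> int (card (S m)) < n - l"
    and L1: "S' \<inter> S p = {}"
    and L2: "int (card S') \<le> n - l - 1"
    and L3: "p \<le> m - 1 \<longrightarrow> \<not> S (p + 1) - S p \<subseteq> S'"
  shows "defines_facet_of
    (\<lambda>(z :: real ^ 'n, \<delta> :: real ^ 'm). \<Sum>j\<in>S'. z $ j)
    (\<lambda>(z, \<delta>). real_of_int (int (card (S' \<union> S p)) - n + l) * \<delta> $ e p
      + (\<Sum>i=p+1..m. (real (card (S' \<union> S i)) - real (card (S' \<union> S (i - 1)))) * \<delta> $ e i))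
    (convex hull (X_set l u S e))"
proof -
  define L U where "L = nat l" and "U = nat u"
  have L: "l = int L" and U: "u = int U" using lu by (auto simp: L_def U_def)
  interpret nested_chain m S
  proof
    show "S 0 = {}" by (rule S0)
    fix i assume "i < m"
    show "S i \<subset> S (Suc i)"
    proof (cases "i = 0")
      case True
      have "S 1 \<noteq> {}" using S_card by auto
      with True show ?thesis using S0 by auto
    next
      case False
      with \<open>i < m\<close> show ?thesis using S_nested by auto
    qed
  qed
  have "card (S p) < card (S m)" if "p < m"
  proof (rule psubset_card_mono)
    show "S p \<subset> S m" using S_Suc[OF that] S_mono[of "Suc p" m] that by auto
  qed simp
  then have S_p: "int (card (S p)) < n - l"
    using case_cond l_le p by (cases "p < m") auto
  interpret lifted_cover m S L U p S'
    by standard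
      (use lu S_card l_le p p_cond S_p L1 L2 L3 in \<open>auto simp: n L U\<close>)
  let ?w = "facet_normal e :: (real ^ 'n) \<times> (real ^ 'm)"
  let ?P = "convex hull (X_set l u S e)"
  let ?f = "\<lambda>(z :: real ^ 'n, \<delta> :: real ^ 'm). \<Sum>j\<in>S'. z $ j"
  let ?g = "\<lambda>(z :: real ^ 'n, \<delta> :: real ^ 'm).
    real_of_int (int (card (S' \<union> S p)) - n + l) * \<delta> $ e p
      + (\<Sum>i=p+1..m. (real (card (S' \<union> S i)) - real (card (S' \<union> S (i - 1)))) * \<delta> $ e i)"
  have w: "?w \<bullet> x = ?f x - ?g x" for x
    using facet_normal_inner[OF e m, of "fst x" "snd x"]
    by (simp add: case_prod_unfold n L algebra_simps)
  have "?f x \<ge> ?g x" if "x \<in> ?P" for x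
  proof -
    have "0 \<le> ?w \<bullet> x" using facet_normal_nonneg[OF e m] that unfolding L U .
    then show ?thesis unfolding w by linarith
  qed
  moreover have "{x \<in> ?P. ?f x = ?g x} = ?P \<inter> {x. ?w \<bullet> x = 0}"
    unfolding w by auto
  then have "{x \<in> ?P. ?f x = ?g x} facet_of ?P"
    using facet_normal_facet[OF e m] by (simp add: L U)
  ultimately show ?thesis unfolding defines_facet_of_def by blast
qed

end
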